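(* Let $H$ be a subgroup of $S_d$, $g\in S_d$, and $p\in(0,1)$ (not necessarily constant). Then the random structures $G^H(n,p)$ and $G^{gHg^{-1}}(n,p)$ are equivalent, i.e. $G^H(n,p)\preceq G^{gHg^{-1}}(n,p)$ and $G^{gHg^{-1}}(n,p)\preceq G^H(n,p)$.
   Context: $S_d$ acts on $d$-tuples by $g(v_1,\dots,v_d)=(v_{g^{-1}(1)},\dots,v_{g^{-1}(d)})$. For a subgroup $H\le S_d$, the binomial $d$-uniform $H$-hypergraph $G^H(n,p)$ is the random structure over $\{=,P_H\}$, $P_H$ of arity $d$, in which each $H$-orbit of the set $[n]_d$ of $d$-tuples of distinct elements of $[n]$ is present (all its tuples satisfy $P_H$) independently with probability $p$, and no other tuples satisfy $P_H$. Stochastic FO reduction: for sequences $D=(D_n)$, $D'=(D'_n)$ of random structures with domain $[n]$ over relational signatures $\sigma,\sigma'$, a map $f$ from finite $\sigma$-structures to finite $\sigma'$-structures preserving the domain $[n]$, such that for every FO sentence $\varphi'$ over $\sigma'$ there is a FO sentence $f^{-1}(\varphi')$ over $\sigma$ with $X\models f^{-1}(\varphi')\iff f(X)\models\varphi'$, and $|\Pr(D_n\models f^{-1}(\varphi'))-\Pr(D'_n\models\varphi')|\to0$. $D'\preceq D$ means such a reduction from $D'$ to $D$ exists. *)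

theory Defs
  imports
    "HOL-Algebra.Sym_Groups"
    "HOL-Probability.Product_PMF"
begin

section \<open>First-order logic with equality over relational signatures\<close>

text \<open>
  A relational signature is a type \<open>'r\<close> of relation symbols together with an arity function
  \<open>'r \<Rightarrow> nat\<close>. Equality belongs to every signature and is interpreted as true equality.
\<close>

datatype 'r fo =
    Eq nat nat
  | Rel 'r "nat list"
  | Neg "'r fo"
  | Conj "'r fo" "'r fo"
  | Exists nat "'r fo"

fun free_vars :: "'r fo \<Rightarrow> nat set" where
  "free_vars (Eq x y) = {x, y}"
| "free_vars (Rel r xs) = set xs"
| "free_vars (Neg \<phi>) = free_vars \<phi>"
| "free_vars (Conj \<phi> \<psi>) = free_vars \<phi> \<union> free_vars \<psi>"
| "free_vars (Exists x \<phi>) = free_vars \<phi> - {x}"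

fun fo_over :: "('r \<Rightarrow> nat) \<Rightarrow> 'r fo \<Rightarrow> bool" where
  "fo_over ar (Eq x y) \<longleftrightarrow> True"
| "fo_over ar (Rel r xs) \<longleftrightarrow> length xs = ar r"
| "fo_over ar (Neg \<phi>) \<longleftrightarrow> fo_over ar \<phi>"
| "fo_over ar (Conj \<phi> \<psi>) \<longleftrightarrow> fo_over ar \<phi> \<and> fo_over ar \<psi>"
| "fo_over ar (Exists x \<phi>) \<longleftrightarrow> fo_over ar \<phi>"

definition fo_sentence :: "('r \<Rightarrow> nat) \<Rightarrow> 'r fo \<Rightarrow> bool" where
  "fo_sentence ar \<phi> \<longleftrightarrow> fo_over ar \<phi> \<and> free_vars \<phi> = {}"

record ('a, 'r) fo_struct =
  universe :: "'a set"
  interp :: "'r \<Rightarrow> 'a list set"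

fun fo_sat :: "('a, 'r) fo_struct \<Rightarrow> (nat \<Rightarrow> 'a) \<Rightarrow> 'r fo \<Rightarrow> bool" where
  "fo_sat X v (Eq x y) \<longleftrightarrow> v x = v y"
| "fo_sat X v (Rel r xs) \<longleftrightarrow> map v xs \<in> interp X r"
| "fo_sat X v (Neg \<phi>) \<longleftrightarrow> \<not> fo_sat X v \<phi>"
| "fo_sat X v (Conj \<phi> \<psi>) \<longleftrightarrow> fo_sat X v \<phi> \<and> fo_sat X v \<psi>"
| "fo_sat X v (Exists x \<phi>) \<longleftrightarrow> (\<exists>a\<in>universe X. fo_sat X (v(x := a)) \<phi>)"

text \<open>
  The valuation is irrelevant for closed formulas, so the arbitrary one used here does not matter.
\<close>

definition fo_models :: "('a, 'r) fo_struct \<Rightarrow> 'r fo \<Rightarrow> bool" (infix \<open>\<Turnstile>\<close> 50) where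
  "X \<Turnstile> \<phi> \<longleftrightarrow> fo_sat X (\<lambda>_. undefined) \<phi>"

text \<open>
  Finite structures have a finite set of natural numbers as universe. The empty universe is not
  excluded, so that the domain \<open>[n] = {1..n}\<close> is admitted for every \<open>n\<close>.
\<close>

definition fin_structs :: "('r \<Rightarrow> nat) \<Rightarrow> (nat, 'r) fo_struct set" where
  "fin_structs ar =
     {X. finite (universe X) \<and>
         (\<forall>r. interp X r \<subseteq> {xs. length xs = ar r \<and> set xs \<subseteq> universe X})}"


section \<open>Stochastic first-order reductions\<close>

definition random_structs :: "('r \<Rightarrow> nat) \<Rightarrow> (nat \<Rightarrow> (nat, 'r) fo_struct pmf) \<Rightarrow> bool" where
  "random_structs ar D \<longleftrightarrow>
     (\<forall>n. set_pmf (D n) \<subseteq> {X \<in> fin_structs ar. universe X = {1..n}})"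

text \<open>
  \<open>fo_reduction ar' D' ar D f\<close>: the map \<open>f\<close> is a stochastic first-order reduction from \<open>D'\<close> to
  \<open>D\<close>; note that it takes structures over the signature of \<open>D\<close> to structures over the signature
  of \<open>D'\<close>.
\<close>

definition fo_reduction ::
  "('s \<Rightarrow> nat) \<Rightarrow> (nat \<Rightarrow> (nat, 's) fo_struct pmf) \<Rightarrow>
   ('r \<Rightarrow> nat) \<Rightarrow> (nat \<Rightarrow> (nat, 'r) fo_struct pmf) \<Rightarrow>
   ((nat, 'r) fo_struct \<Rightarrow> (nat, 's) fo_struct) \<Rightarrow> bool" where
  "fo_reduction ar' D' ar D f \<longleftrightarrow>
     random_structs ar' D' \<and> random_structs ar D \<and>
     (\<forall>X\<in>fin_structs ar. f X \<in> fin_structs ar' \<and> universe (f X) = universe X) \<and>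
     (\<forall>\<phi>'. fo_sentence ar' \<phi>' \<longrightarrow>
        (\<exists>\<phi>. fo_sentence ar \<phi> \<and>
             (\<forall>X\<in>fin_structs ar. X \<Turnstile> \<phi> \<longleftrightarrow> f X \<Turnstile> \<phi>') \<and>
             (\<lambda>n. \<bar>measure_pmf.prob (D n) {X. X \<Turnstile> \<phi>} -
                   measure_pmf.prob (D' n) {Y. Y \<Turnstile> \<phi>'}\<bar>) \<longlonglongrightarrow> 0))"

definition fo_reducible ::
  "('s \<Rightarrow> nat) \<Rightarrow> (nat \<Rightarrow> (nat, 's) fo_struct pmf) \<Rightarrow>
   ('r \<Rightarrow> nat) \<Rightarrow> (nat \<Rightarrow> (nat, 'r) fo_struct pmf) \<Rightarrow> bool" where
  "fo_reducible ar' D' ar D \<longleftrightarrow> (\<exists>f. fo_reduction ar' D' ar D f)"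


section \<open>Binomial \<open>H\<close>-hypergraphs\<close>

text \<open>
  A \<open>d\<close>-tuple is a list of length \<open>d\<close>. Permutations act on the positions \<open>1, \<dots>, d\<close> whereas list
  indices start at \<open>0\<close>, hence the shift: the \<open>i\<close>-th entry of \<open>tuple_act d g v\<close> is the entry of
  \<open>v\<close> at position \<open>g\<^sup>-\<^sup>1(i)\<close>.
\<close>

definition tuple_act :: "nat \<Rightarrow> (nat \<Rightarrow> nat) \<Rightarrow> 'a list \<Rightarrow> 'a list" where
  "tuple_act d g v = map (\<lambda>i. v ! (inv' g i - 1)) [1..<Suc d]"

definition distinct_tuples :: "nat \<Rightarrow> nat \<Rightarrow> nat list set" where
  "distinct_tuples n d = {v. length v = d \<and> distinct v \<and> set v \<subseteq> {1..n}}"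

definition tuple_orbits :: "nat \<Rightarrow> (nat \<Rightarrow> nat) set \<Rightarrow> nat \<Rightarrow> nat list set set" where
  "tuple_orbits d H n = (\<lambda>v. (\<lambda>h. tuple_act d h v) ` H) ` distinct_tuples n d"

datatype hyp_symbol = P

definition hyp_arity :: "nat \<Rightarrow> hyp_symbol \<Rightarrow> nat" where
  "hyp_arity d = (\<lambda>_. d)"

text \<open>
  The Boolean \<open>\<omega> Q\<close> records whether the orbit \<open>Q\<close> is present.
\<close>

definition binomial_hypergraph ::
  "nat \<Rightarrow> (nat \<Rightarrow> nat) set \<Rightarrow> nat \<Rightarrow> real \<Rightarrow> (nat, hyp_symbol) fo_struct pmf" where
  "binomial_hypergraph d H n p =
     map_pmf
       (\<lambda>\<omega>. \<lparr>universe = {1..n}, interp = (\<lambda>_. \<Union>{Q \<in> tuple_orbits d H n. \<omega> Q})\<rparr>)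
       (Pi_pmf (tuple_orbits d H n) False (\<lambda>_. bernoulli_pmf p))"

end

theory Submission
  imports Defs
begin

text \<open>
  Permuting coordinates by \<open>g\<close> maps the \<open>H\<close>-orbit of \<open>v\<close> onto the \<open>gHg\<^sup>-\<^sup>1\<close>-orbit of \<open>gv\<close>. Hence
  pulling back the hyperedge relation along \<open>v \<mapsto> gv\<close> turns \<open>G\<^bsup>gHg\<^sup>-\<^sup>1\<^esup>(n,p)\<close> into a structure with
  exactly the distribution of \<open>G\<^sup>H(n,p)\<close>. The pullback is first-order: it permutes the arguments of
  every atomic formula. The other direction is the same statement for \<open>g\<^sup>-\<^sup>1\<close>.
\<close>

section \<open>Permutations acting on tuples\<close>

lemma length_tuple_act [simp]: "length (tuple_act d g v) = d"
  by (simp add: tuple_act_def)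

lemma nth_tuple_act: "i < d \<Longrightarrow> tuple_act d g v ! i = v ! (inv' g (Suc i) - 1)"
  by (simp add: tuple_act_def del: upt_Suc)

lemma inv_permutes_interval:
  fixes g :: "nat \<Rightarrow> nat"
  assumes "g permutes {1..d}" "i < d"
  shows "inv' g (Suc i) \<in> {1..d}"
  using permutes_in_image[OF permutes_inv[OF assms(1)], of "Suc i"] assms(2) by simp

lemma inv_permutes_index_less:
  fixes g :: "nat \<Rightarrow> nat"
  assumes "g permutes {1..d}" "i < d"
  shows "inv' g (Suc i) - 1 < d"
  using inv_permutes_interval[OF assms] by auto

text \<open>Entries are looked up through the inverse permutation; inverting
  \<open>g \<circ> h\<close> reverses the factors, which compensates for the reversal caused by the
  lookup and yields a left action.\<close>

lemma tuple_act_comp: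
  assumes "g permutes {1..d}" "h permutes {1..d}"
  shows "tuple_act d (g \<circ> h) v = tuple_act d g (tuple_act d h v)"
proof (rule nth_equalityI)
  fix i assume "i < length (tuple_act d (g \<circ> h) v)"
  then have i: "i < d" by simp
  have "inv' (g \<circ> h) = inv' h \<circ> inv' g"
    using assms by (simp add: o_inv_distrib permutes_bij)
  \<comment> \<open>Positions start at 1 and list indices at 0; the truncated subtraction is exact
    because \<open>inv' g\<close> maps \<open>Suc i\<close> into \<open>{1..d}\<close>.\<close>
  moreover have "Suc (inv' g (Suc i) - 1) = inv' g (Suc i)"
    using inv_permutes_interval[OF assms(1) i] by simp
  ultimately show "tuple_act d (g \<circ> h) v ! i = tuple_act d g (tuple_act d h v) ! i"
    using i inv_permutes_index_less[OF assms(1) i] by (simp add: nth_tuple_act)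
qed simp

lemma tuple_act_id: "length v = d \<Longrightarrow> tuple_act d id v = v"
  by (rule nth_equalityI) (simp_all add: nth_tuple_act)

lemma tuple_act_inv:
  assumes "g permutes {1..d}" "length v = d"
  shows "tuple_act d g (tuple_act d (inv' g) v) = v"
    and "tuple_act d (inv' g) (tuple_act d g v) = v"
  using assms
  by (simp_all add: tuple_act_comp[symmetric] permutes_inv permutes_inv_o tuple_act_id)

text \<open>\<open>g\<close> moves positions and \<open>f\<close> changes entries, so the two
  commute. With a valuation as \<open>f\<close>, permuting the variables of an atom permutes their
  values.\<close>

lemma map_tuple_act:
  assumes "g permutes {1..d}" "length v = d"
  shows "map f (tuple_act d g v) = tuple_act d g (map f v)"
proof (rule nth_equalityI)
  fix i assume "i < length (map f (tuple_act d g v))"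
  then show "map f (tuple_act d g v) ! i = tuple_act d g (map f v) ! i"
    using assms(2) inv_permutes_index_less[OF assms(1)] by (simp add: nth_tuple_act)
qed simp

lemma set_tuple_act_subset:
  assumes "g permutes {1..d}" "length v = d"
  shows "set (tuple_act d g v) \<subseteq> set v"
proof
  fix x assume "x \<in> set (tuple_act d g v)"
  then obtain i where "i < d" "x = v ! (inv' g (Suc i) - 1)"
    by (auto simp: in_set_conv_nth nth_tuple_act)
  then show "x \<in> set v"
    using inv_permutes_index_less[OF assms(1)] assms(2) by simp
qed

lemma set_tuple_act:
  assumes "g permutes {1..d}" "length v = d"
  shows "set (tuple_act d g v) = set v"
  \<comment> \<open>The reverse inclusion is the same lemma for \<open>inv' g\<close> and the tuple
    \<open>tuple_act d g v\<close>.\<close>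
  using set_tuple_act_subset[OF assms]
    set_tuple_act_subset[OF permutes_inv[OF assms(1)], of "tuple_act d g v"]
  by (simp add: tuple_act_inv[OF assms])

lemma tuple_act_distinct_tuples:
  assumes "g permutes {1..d}" "v \<in> distinct_tuples n d"
  shows "tuple_act d g v \<in> distinct_tuples n d"
proof -
  from assms(2) have v: "length v = d" "distinct v" "set v \<subseteq> {1..n}"
    by (auto simp: distinct_tuples_def)
  \<comment> \<open>Distinctness follows by counting, as the length and the set of entries are
    preserved.\<close>
  have "card (set (tuple_act d g v)) = length (tuple_act d g v)"
    using v by (simp add: set_tuple_act[OF assms(1)] distinct_card)
  then show ?thesis
    using v by (simp add: distinct_tuples_def set_tuple_act[OF assms(1)] card_distinct)
qed

lemma tuple_act_image_distinct_tuples: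
  assumes "g permutes {1..d}"
  shows "tuple_act d g ` distinct_tuples n d = distinct_tuples n d"
proof
  show "distinct_tuples n d \<subseteq> tuple_act d g ` distinct_tuples n d"
  proof
    fix v assume v: "v \<in> distinct_tuples n d"
    then have "v = tuple_act d g (tuple_act d (inv' g) v)"
      using assms by (simp add: tuple_act_inv distinct_tuples_def)
    then show "v \<in> tuple_act d g ` distinct_tuples n d"
      using tuple_act_distinct_tuples[OF permutes_inv[OF assms] v] by blast
  qed
qed (use tuple_act_distinct_tuples[OF assms] in blast)

section \<open>Orbits and conjugation\<close>

lemma finite_distinct_tuples: "finite (distinct_tuples n d)"
  by (rule finite_subset[OF _ finite_lists_length_eq[of "{1..n}" d]])
    (auto simp: distinct_tuples_def)

lemma tuple_orbits_subset:
  assumes "\<And>h. h \<in> H \<Longrightarrow> h permutes {1..d}" "Q \<in> tuple_orbits d H n"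
  shows "Q \<subseteq> distinct_tuples n d"
  using assms tuple_act_distinct_tuples by (fastforce simp: tuple_orbits_def)

lemma conjugate_permutes:
  assumes "g permutes S" "\<And>h. h \<in> H \<Longrightarrow> h permutes S" "k \<in> (\<lambda>h. g \<circ> h \<circ> inv' g) ` H"
  shows "k permutes S"
proof -
  from assms(3) obtain h where "h \<in> H" "k = g \<circ> h \<circ> inv' g" by blast
  then show ?thesis
    using assms(1,2) by (simp add: permutes_compose permutes_inv)
qed

text \<open>Acting by \<open>g \<circ> h \<circ> inv' g\<close> on \<open>v\<close> means acting by
  \<open>g\<close> on the \<open>h\<close>-image of \<open>tuple_act d (inv' g) v\<close>, and the
  latter tuple runs through all distinct tuples as \<open>v\<close> does.\<close>

lemma tuple_orbits_conjugate:
  assumes g: "g permutes {1..d}" and H: "\<And>h. h \<in> H \<Longrightarrow> h permutes {1..d}"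
  shows "tuple_orbits d ((\<lambda>h. g \<circ> h \<circ> inv' g) ` H) n = (\<lambda>Q. tuple_act d g ` Q) ` tuple_orbits d H n"
proof -
  have *: "tuple_act d (g \<circ> h \<circ> inv' g) v = tuple_act d g (tuple_act d h (tuple_act d (inv' g) v))"
    if "h \<in> H" for h and v :: "nat list"
    using g H[OF that]
    by (simp add: tuple_act_comp permutes_compose permutes_inv)
  have "tuple_orbits d ((\<lambda>h. g \<circ> h \<circ> inv' g) ` H) n =
      (\<lambda>v. tuple_act d g ` (\<lambda>h. tuple_act d h (tuple_act d (inv' g) v)) ` H) ` distinct_tuples n d"
    unfolding tuple_orbits_def image_image using * by (intro image_cong refl) auto
  also have "\<dots> = (\<lambda>v. tuple_act d g ` (\<lambda>h. tuple_act d h v) ` H) `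
      tuple_act d (inv' g) ` distinct_tuples n d"
    by (simp add: image_image)
  also have "\<dots> = (\<lambda>Q. tuple_act d g ` Q) ` tuple_orbits d H n"
    by (simp add: tuple_act_image_distinct_tuples[OF permutes_inv[OF g]] tuple_orbits_def image_image)
  finally show ?thesis .
qed

text \<open>The restriction to length \<open>d\<close> matters: only the first \<open>d\<close>
  entries are read, so longer lists with a common prefix collide.\<close>

lemma inj_on_tuple_act:
  assumes "g permutes {1..d}"
  shows "inj_on (tuple_act d g) {v. length v = d}"
  by (rule inj_on_inverseI[where g = "tuple_act d (inv' g)"]) (simp add: tuple_act_inv[OF assms])

section \<open>Pullback of structures and translation of formulas\<close>

definition pullback_struct ::
  "nat \<Rightarrow> (nat \<Rightarrow> nat) \<Rightarrow> ('a, 'r) fo_struct \<Rightarrow> ('a, 'r) fo_struct" where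
  "pullback_struct d g X =
     \<lparr>universe = universe X, interp = (\<lambda>r. {v. length v = d \<and> tuple_act d g v \<in> interp X r})\<rparr>"

fun permute_atoms :: "nat \<Rightarrow> (nat \<Rightarrow> nat) \<Rightarrow> 'r fo \<Rightarrow> 'r fo" where
  "permute_atoms d g (Eq x y) = Eq x y"
| "permute_atoms d g (Rel r xs) = Rel r (tuple_act d g xs)"
| "permute_atoms d g (Neg \<phi>) = Neg (permute_atoms d g \<phi>)"
| "permute_atoms d g (Conj \<phi> \<psi>) = Conj (permute_atoms d g \<phi>) (permute_atoms d g \<psi>)"
| "permute_atoms d g (Exists x \<phi>) = Exists x (permute_atoms d g \<phi>)"

text \<open>Atoms agree because \<open>g\<close> commutes with the valuation, where
  \<open>fo_over\<close> supplies the argument length \<open>d\<close>; quantifiers agree because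
  the pullback keeps the universe.\<close>

lemma fo_sat_permute_atoms:
  assumes "g permutes {1..d}" "fo_over (\<lambda>_. d) \<phi>"
  shows "fo_sat X v (permute_atoms d g \<phi>) \<longleftrightarrow> fo_sat (pullback_struct d g X) v \<phi>"
  using assms(2)
  by (induction \<phi> arbitrary: v) (simp_all add: pullback_struct_def map_tuple_act[OF assms(1)])

lemma fo_sentence_permute_atoms:
  assumes "g permutes {1..d}" "fo_sentence (\<lambda>_. d) \<phi>"
  shows "fo_sentence (\<lambda>_. d) (permute_atoms d g \<phi>)"
proof -
  have "fo_over (\<lambda>_. d) (permute_atoms d g \<psi>) \<and> free_vars (permute_atoms d g \<psi>) = free_vars \<psi>"
    if "fo_over (\<lambda>_. d) \<psi>" for \<psi> :: "'a fo"
    using that by (induction \<psi>) (simp_all add: set_tuple_act[OF assms(1)])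
  then show ?thesis
    using assms(2) by (simp add: fo_sentence_def)
qed

text \<open>The length clause in \<open>pullback_struct\<close> enforces the arity, since
  \<open>tuple_act\<close> returns a list of length \<open>d\<close> whatever the length of its
  argument.\<close>

lemma pullback_struct_fin_structs:
  assumes "g permutes {1..d}" "X \<in> fin_structs (\<lambda>_. d)"
  shows "pullback_struct d g X \<in> fin_structs (\<lambda>_. d)"
  using assms(2) set_tuple_act[OF assms(1)]
  unfolding fin_structs_def pullback_struct_def by fastforce

section \<open>Distributions and the reduction\<close>

lemma random_structs_binomial_hypergraph:
  assumes "\<And>h. h \<in> H \<Longrightarrow> h permutes {1..d}"
  shows "random_structs (\<lambda>_. d) (\<lambda>n. binomial_hypergraph d H n (p n))"
  using tuple_orbits_subset[OF assms]
  by (fastforce simp: random_structs_def binomial_hypergraph_def fin_structs_def distinct_tuples_def)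

text \<open>\<open>Q \<mapsto> gQ\<close> is a bijection between the two families of orbits, so it
  merely re-indexes independent coins of equal bias, and pulling back the edge set turns each
  present orbit \<open>gQ\<close> into \<open>Q\<close>.\<close>

lemma pullback_binomial_hypergraph_conjugate:
  assumes g: "g permutes {1..d}" and H: "\<And>h. h \<in> H \<Longrightarrow> h permutes {1..d}"
  shows "map_pmf (pullback_struct d g) (binomial_hypergraph d ((\<lambda>h. g \<circ> h \<circ> inv' g) ` H) n p) =
    binomial_hypergraph d H n p"
proof -
  define H' where "H' = (\<lambda>h. g \<circ> h \<circ> inv' g) ` H"
  define A where "A = tuple_orbits d H n"
  define B where "B = tuple_orbits d H' n"
  \<comment> \<open>Transporting \<open>Pi_pmf\<close> along \<open>\<beta>\<close> requires that \<open>\<beta>\<close> maps everything outside \<open>A\<close> to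
    something outside \<open>B\<close>; tuples of length \<open>d + 1\<close> occur in no orbit.\<close>
  define \<beta> where "\<beta> Q = (if Q \<in> A then tuple_act d g ` Q else {replicate (Suc d) 0})" for Q
  have B: "B = (\<lambda>Q. tuple_act d g ` Q) ` A"
    unfolding A_def B_def H'_def by (rule tuple_orbits_conjugate[OF g H])
  have A_length: "length v = d" if "Q \<in> A" "v \<in> Q" for Q v
    using tuple_orbits_subset[OF H] that by (auto simp: A_def distinct_tuples_def)
  have "inj_on (\<lambda>Q. tuple_act d g ` Q) A"
    using A_length by (intro inj_on_image inj_on_subset[OF inj_on_tuple_act[OF g]]) auto
  then have bij: "bij_betw \<beta> A B"
    by (simp add: bij_betw_def B \<beta>_def inj_on_def)
  have outside: "\<beta> Q \<notin> B" if "Q \<notin> A" for Q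
  proof
    assume "\<beta> Q \<in> B"
    then have "{replicate (Suc d) 0} \<in> B" using that by (simp add: \<beta>_def)
    then obtain R where R: "{replicate (Suc d) (0::nat)} = tuple_act d g ` R" 
      unfolding B by blast
    have "length w = d" if "w \<in> {replicate (Suc d) (0::nat)}" for w
      using that unfolding R by auto
    then have "length (replicate (Suc d) (0::nat)) = d" by blast
    then show False by simp
  qed
  have "finite A"
    by (simp add: A_def tuple_orbits_def finite_distinct_tuples)
  then have Pi: "Pi_pmf A False (\<lambda>_. bernoulli_pmf p) =
      map_pmf (\<lambda>\<omega>. \<omega> \<circ> \<beta>) (Pi_pmf B False (\<lambda>_. bernoulli_pmf p))"
    by (rule Pi_pmf_bij_betw[OF _ bij outside])
  \<comment> \<open>For each fixed outcome \<open>\<omega>\<close> on \<open>B\<close>, the coins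
    \<open>\<omega> \<circ> \<beta>\<close> on \<open>A\<close> produce exactly the pulled-back edge
    set.\<close>
  have union: "\<Union>{Q \<in> A. \<omega> (\<beta> Q)} = {v. length v = d \<and> tuple_act d g v \<in> \<Union>{Q \<in> B. \<omega> Q}}" for \<omega>
  proof (intro Set.set_eqI iffI)
    fix v assume "v \<in> {v. length v = d \<and> tuple_act d g v \<in> \<Union>{Q \<in> B. \<omega> Q}}"
    then obtain Q u where Q: "Q \<in> A" "\<omega> (tuple_act d g ` Q)"
      and u: "u \<in> Q" "tuple_act d g v = tuple_act d g u" and v: "length v = d"
      unfolding B by blast
    have "v = u"
      using inj_onD[OF inj_on_tuple_act[OF g] u(2)] v A_length[OF Q(1) u(1)] by simp
    then show "v \<in> \<Union>{Q \<in> A. \<omega> (\<beta> Q)}" using Q u by (auto simp: \<beta>_def)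
  qed (use A_length in \<open>auto simp: B \<beta>_def\<close>)
  show ?thesis
    \<comment> \<open>By \<open>Pi\<close> both sides become images of the same product distribution
      over \<open>B\<close>; \<open>union\<close> identifies the two maps.\<close>
    unfolding binomial_hypergraph_def H'_def[symmetric] A_def[symmetric] B_def[symmetric] Pi
    by (simp add: map_pmf_comp pullback_struct_def union[simplified])
qed

lemma fo_reducible_conjugate:
  assumes g: "g permutes {1..d}" and H: "\<And>h. h \<in> H \<Longrightarrow> h permutes {1..d}"
  shows "fo_reducible (hyp_arity d) (\<lambda>n. binomial_hypergraph d H n (p n))
    (hyp_arity d) (\<lambda>n. binomial_hypergraph d ((\<lambda>h. g \<circ> h \<circ> inv' g) ` H) n (p n))"
proof -
  let ?D = "\<lambda>n. binomial_hypergraph d H n (p n)"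
  let ?D' = "\<lambda>n. binomial_hypergraph d ((\<lambda>h. g \<circ> h \<circ> inv' g) ` H) n (p n)"
  have sat: "X \<Turnstile> permute_atoms d g \<phi> \<longleftrightarrow> pullback_struct d g X \<Turnstile> \<phi>"
    if "fo_sentence (\<lambda>_. d) \<phi>" for X :: "(nat, hyp_symbol) fo_struct" and \<phi>
    using that by (simp add: fo_models_def fo_sentence_def fo_sat_permute_atoms[OF g])
  \<comment> \<open>The law \<open>?D n\<close> is the image of \<open>?D' n\<close> under the
    pullback, so the probabilities coincide for every \<open>n\<close> and the limit below is that
    of the zero sequence.\<close>
  have prob: "measure_pmf.prob (?D' n) {X. X \<Turnstile> permute_atoms d g \<phi>} =
      measure_pmf.prob (?D n) {Y. Y \<Turnstile> \<phi>}" if "fo_sentence (\<lambda>_. d) \<phi>" for n \<phi>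
    by (subst pullback_binomial_hypergraph_conjugate[OF g H, symmetric])
      (simp_all add: sat[OF that] vimage_def)
  have "fo_reduction (\<lambda>_. d) ?D (\<lambda>_. d) ?D' (pullback_struct d g)"
    unfolding fo_reduction_def
  proof (intro conjI ballI allI impI)
    show "random_structs (\<lambda>_. d) ?D" "random_structs (\<lambda>_. d) ?D'"
      by (intro random_structs_binomial_hypergraph H conjugate_permutes[OF g H]; assumption)+
  next
    fix \<phi> :: "hyp_symbol fo" assume \<phi>: "fo_sentence (\<lambda>_. d) \<phi>"
    show "\<exists>\<psi>. fo_sentence (\<lambda>_. d) \<psi> \<and>
        (\<forall>X\<in>fin_structs (\<lambda>_. d). X \<Turnstile> \<psi> \<longleftrightarrow> pullback_struct d g X \<Turnstile> \<phi>) \<and>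
        (\<lambda>n. \<bar>measure_pmf.prob (?D' n) {X. X \<Turnstile> \<psi>} -
              measure_pmf.prob (?D n) {Y. Y \<Turnstile> \<phi>}\<bar>) \<longlonglongrightarrow> 0"
      by (rule exI[of _ "permute_atoms d g \<phi>"])
        (simp add: fo_sentence_permute_atoms[OF g \<phi>] sat[OF \<phi>] prob[OF \<phi>, unfolded sat[OF \<phi>]])
  qed (simp_all add: pullback_struct_fin_structs[OF g], simp add: pullback_struct_def)
  then show ?thesis
    unfolding fo_reducible_def hyp_arity_def by blast
qed

theorem theorem7:
  fixes d :: nat and H :: "(nat \<Rightarrow> nat) set" and g :: "nat \<Rightarrow> nat" and p :: "nat \<Rightarrow> real"
  assumes "subgroup H (sym_group d)"
    and "g \<in> carrier (sym_group d)"
    and "\<And>n. 0 < p n \<and> p n < 1"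
  defines "H' \<equiv> g <#\<^bsub>sym_group d\<^esub> H #>\<^bsub>sym_group d\<^esub> inv\<^bsub>sym_group d\<^esub> g"
  shows "fo_reducible (hyp_arity d) (\<lambda>n. binomial_hypergraph d H n (p n))
                      (hyp_arity d) (\<lambda>n. binomial_hypergraph d H' n (p n))
       \<and> fo_reducible (hyp_arity d) (\<lambda>n. binomial_hypergraph d H' n (p n))
                      (hyp_arity d) (\<lambda>n. binomial_hypergraph d H n (p n))"
proof -
  have g: "g permutes {1..d}"
    using assms(2) by (simp add: sym_group_def)
  have H: "h permutes {1..d}" if "h \<in> H" for h
    using subgroup.mem_carrier[OF assms(1) that] by (simp add: sym_group_def)
  have H': "H' = (\<lambda>h. g \<circ> h \<circ> inv' g) ` H"
    unfolding H'_def sym_group_inv_equality[OF assms(2)] l_coset_def r_coset_def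
    by (auto simp: sym_group_def)
  \<comment> \<open>Conjugation by \<open>inv' g\<close> undoes conjugation by \<open>g\<close>, so
    the second reduction is the first one applied to \<open>H'\<close> and
    \<open>inv' g\<close>.\<close>
  have "inv' g \<circ> (g \<circ> h \<circ> inv' g) \<circ> inv' (inv' g) = h" for h
    using permutes_inv_o[OF g] permutes_inv_inv[OF g] by (metis comp_assoc comp_id id_comp)
  then have H_eq: "H = (\<lambda>h. inv' g \<circ> h \<circ> inv' (inv' g)) ` H'"
    by (simp add: H' image_image)
  have "fo_reducible (hyp_arity d) (\<lambda>n. binomial_hypergraph d H n (p n))
      (hyp_arity d) (\<lambda>n. binomial_hypergraph d H' n (p n))"
    unfolding H' by (rule fo_reducible_conjugate[OF g H])
  moreover have "fo_reducible (hyp_arity d) (\<lambda>n. binomial_hypergraph d H' n (p n))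
      (hyp_arity d) (\<lambda>n. binomial_hypergraph d H n (p n))"
    by (subst H_eq, rule fo_reducible_conjugate[OF permutes_inv[OF g]])
      (rule conjugate_permutes[OF g H], simp_all add: H')
  ultimately show ?thesis ..
qed

end
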